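(* Let $g > 1$ be an odd integer, and let $k>0$ be an integer. Let $q = \left\lfloor \frac{2k}{g-1}\right\rfloor$, and let $r = k \bmod \frac{g-1}{2}$ (the remainder, $0\le r<\frac{g-1}{2}$), so that $k = q\left(\frac{g-1}{2}\right) + r$. Let $$A = \begin{cases} \frac{g-1}{2} & \text{if } r = 0,\\ -\left(\frac{g-1}{2}\right) & \text{otherwise;}\end{cases}\qquad B = \begin{cases} 0 & \text{if } r = 0,\\ r & \text{otherwise.}\end{cases}$$ Then $$\lambda_g(k) = \frac{1 - g^{q-1}}{2} + A g^{q-1} + B g^{q}.$$
   Context: For a group $G$ with generating set $S$, the Cayley graph $\Gamma(G,S)$ has vertex set $G$, with $x$ and $y$ joined by an edge whenever $xs=y$ for some $s\in S$; it carries the shortest-path metric in which every edge has length $1$. For an integer $g\ge 2$, let $S_g=\{\pm g^i : i\in\mathbb{Z}_{\ge 0}\}$ and let $C_g=\Gamma(\mathbb{Z},S_g)$ be the Cayley graph of the additive group $\mathbb{Z}$. The $g$-length $\ell_g(n)$ of an integer $n$ is the distance from $0$ to $n$ in $C_g$, i.e. the least number of terms in an expression of $n$ as a sum of elements of $S_g$ (repetitions allowed; $\ell_g(0)=0$). For a positive integer $h$, $\lambda_g(h)$ denotes the smallest positive integer $n$ (in the usual order) with $\ell_g(n)=h$. Powers of $g$ with negative exponent (which occur when $q=0$) are rational numbers. *)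

theory Defs
  imports Complex_Main "Graph_Theory.Graph_Theory"
begin

text \<open>
  Groups are written additively, as in the case of interest (the group of integers);
  class \<open>group_add\<close> does not assume commutativity.  An undirected edge
  is represented by its two arcs.
\<close>

definition cayley_graph :: "'a::group_add set \<Rightarrow> 'a pair_pre_digraph" where
  "cayley_graph S =
     \<lparr> pverts = UNIV, parcs = {(x, y). \<exists>s\<in>S. x + s = y \<or> y + s = x} \<rparr>"

lemma pair_wf_digraph_cayley_graph: "pair_wf_digraph (cayley_graph S)"
  by unfold_locales (auto simp: cayley_graph_def)

lemma wf_digraph_cayley_graph: "wf_digraph (with_proj (cayley_graph S))"
  by unfold_locales (auto simp: cayley_graph_def)

lemma symmetric_cayley_graph: "symmetric (with_proj (cayley_graph S))"
  by (auto simp: symmetric_def cayley_graph_def sym_def)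

text \<open>Every edge has length 1; the distance is infinite between vertices not joined by a walk.\<close>

definition cayley_dist :: "'a::group_add set \<Rightarrow> 'a \<Rightarrow> 'a \<Rightarrow> ereal" where
  "cayley_dist S x y = wf_digraph.\<mu> (with_proj (cayley_graph S)) (\<lambda>_. 1) x y"

definition gen_powers :: "int \<Rightarrow> int set" where
  "gen_powers g = {s. \<exists>i::nat. s = g ^ i \<or> s = - (g ^ i)}"

definition g_length :: "int \<Rightarrow> int \<Rightarrow> ereal" where
  "g_length g n = cayley_dist (gen_powers g) 0 n"

text \<open>If no such \<open>n\<close> exists, the value is unspecified.\<close>

definition lambda_g :: "int \<Rightarrow> int \<Rightarrow> int" where
  "lambda_g g h = (LEAST n::int. n > 0 \<and> g_length g n = ereal (of_int h))"

end

theory Submission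
  imports Defs
begin

text \<open>
  Write \<open>g = 2 * m + 1\<close>. Every integer has a unique balanced expansion
  \<open>n = (\<Sum>i. s\<^sub>i * g ^ i)\<close> with digits \<open>\<bar>s\<^sub>i\<bar> \<le> m\<close>, and the proof rests on
  the fact that this expansion is geodesic: the length of \<open>n\<close> is the sum of the absolute values of
  its digits (\<open>g_length_eq_digit_sum\<close>). On the one hand, the digit sum is 1-Lipschitz along the edges
  of the Cayley graph: adding a power of \<open>g\<close> raises one digit by 1, and if that digit was \<open>m\<close>, it
  becomes \<open>- m\<close>, which has the same absolute value, and the carry is again the addition of a power
  of \<open>g\<close>. So a walk from 0 to \<open>n\<close> has at least as many edges as the digit sum of \<open>n\<close>. On the other
  hand, moving a nonzero digit one unit towards 0 is an edge along which the digit sum drops by 1,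
  so this bound is attained.

  It remains to find the least positive integer with digit sum \<open>k\<close>. Write \<open>k = m * d + a\<close> with
  \<open>1 \<le> a \<le> m\<close>. Since balanced expansions are ordered lexicographically, the smallest
  candidate fills the \<open>d\<close> lower digits with \<open>- m\<close>, which contributes as much length as possible at
  the least possible value, and puts the remaining \<open>a\<close> in the top digit. Every integer of smaller
  absolute value has a strictly smaller digit sum (\<open>digit_sum_below_least_with_top\<close>).
  The value of the candidate is
  \<open>a * g ^ d - (g ^ d - 1) / 2\<close>. The two cases of the final formula arise because \<open>a\<close> ranges over
  \<open>1..m\<close> and a remainder modulo \<open>m\<close> over \<open>0..m - 1\<close>: for \<open>r = 0\<close> the top digit is \<open>m\<close> in position
  \<open>q - 1\<close>, otherwise it is \<open>r\<close> in position \<open>q\<close>.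
\<close>

section \<open>Distances from the identity in a Cayley graph\<close>

lemma cayley_awalk_Lipschitz:
  fixes f :: "'a::group_add \<Rightarrow> nat"
  assumes step: "\<And>x s. s \<in> S \<Longrightarrow> f (x + s) \<le> f x + 1 \<and> f x \<le> f (x + s) + 1"
    and walk: "pre_digraph.awalk (with_proj (cayley_graph S)) u p v"
  shows "f v \<le> f u + length p"
  using walk
proof (induction p arbitrary: u)
  case Nil
  interpret wf_digraph "with_proj (cayley_graph S)" by (rule wf_digraph_cayley_graph)
  show ?case using Nil by (simp add: awalk_Nil_iff)
next
  case (Cons e p)
  interpret wf_digraph "with_proj (cayley_graph S)" by (rule wf_digraph_cayley_graph)
  have e: "(u, snd e) \<in> parcs (cayley_graph S)" and p: "awalk (snd e) p v"
    using Cons.prems by (auto simp: awalk_Cons_iff)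
  have "f (snd e) \<le> f u + 1"
  proof -
    from e obtain s where "s \<in> S" "u + s = snd e \<or> snd e + s = u"
      by (auto simp: cayley_graph_def)
    then show ?thesis using step[of s u] step[of s "snd e"] by auto
  qed
  with Cons.IH[OF p] show ?case by simp
qed

lemma cayley_awalk_of_descent:
  fixes f :: "'a::group_add \<Rightarrow> nat"
  assumes descent: "\<And>x. x \<noteq> 0 \<Longrightarrow> \<exists>y. (y, x) \<in> parcs (cayley_graph S) \<and> f x = f y + 1"
    and zero: "f 0 = 0"
  shows "\<exists>p. pre_digraph.awalk (with_proj (cayley_graph S)) 0 p x \<and> length p = f x"
proof (induction "f x" arbitrary: x)
  case 0
  interpret wf_digraph "with_proj (cayley_graph S)" by (rule wf_digraph_cayley_graph)
  have "x = 0" using descent[of x] 0 by auto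
  moreover have "0 \<in> pverts (cayley_graph S)" by (simp add: cayley_graph_def)
  then have "awalk 0 [] 0" by (simp add: awalk_Nil_iff)
  ultimately show ?case using zero by (intro exI[of _ "[]"]) simp
next
  case (Suc l)
  interpret wf_digraph "with_proj (cayley_graph S)" by (rule wf_digraph_cayley_graph)
  have "x \<noteq> 0" using Suc.hyps(2) zero by auto
  then obtain y where y: "(y, x) \<in> parcs (cayley_graph S)" "f x = f y + 1"
    using descent by blast
  then obtain p where p: "awalk 0 p y" "length p = f y"
    using Suc by fastforce
  have "x \<in> pverts (cayley_graph S)" by (simp add: cayley_graph_def)
  then have "awalk y [(y, x)] x"
    using y(1) by (simp add: awalk_Cons_iff awalk_Nil_iff)
  then have "awalk 0 (p @ [(y, x)]) x"
    using p(1) awalk_appendI by blast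
  then show ?case using p(2) y(2) by (intro exI[of _ "p @ [(y, x)]"]) simp
qed

text \<open>
  A function that changes by at most 1 along every edge is a lower bound for the distance from a
  zero of it; if from every other vertex some edge lowers it by 1, following such edges down to the
  identity gives a walk that attains the bound.
\<close>

theorem cayley_dist_eqI:
  fixes f :: "'a::group_add \<Rightarrow> nat"
  assumes zero: "f 0 = 0"
    and step: "\<And>x s. s \<in> S \<Longrightarrow> f (x + s) \<le> f x + 1 \<and> f x \<le> f (x + s) + 1"
    and descent: "\<And>x. x \<noteq> 0 \<Longrightarrow> \<exists>y. (y, x) \<in> parcs (cayley_graph S) \<and> f x = f y + 1"
  shows "cayley_dist S 0 x = ereal (real (f x))"
proof -
  interpret wf_digraph "with_proj (cayley_graph S)" by (rule wf_digraph_cayley_graph)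
  have cost: "awalk_cost (\<lambda>_. 1) p = real (length p)" for p :: "('a \<times> 'a) list"
    by (induction p) auto
  obtain p where p: "awalk 0 p x" "length p = f x"
    using cayley_awalk_of_descent[of S f] descent zero by blast
  have "\<mu> (\<lambda>_. 1) 0 x = ereal (real (f x))"
    unfolding \<mu>_def
  proof (rule antisym)
    show "(INF p\<in>{p. awalk 0 p x}. ereal (awalk_cost (\<lambda>_. 1) p)) \<le> ereal (real (f x))"
      using p by (intro INF_lower2[of p]) (auto simp: cost)
    show "ereal (real (f x)) \<le> (INF p\<in>{p. awalk 0 p x}. ereal (awalk_cost (\<lambda>_. 1) p))"
      using cayley_awalk_Lipschitz[of S f 0 _ x] step zero
      by (intro INF_greatest) (auto simp: cost)
  qed
  then show ?thesis by (simp add: cayley_dist_def)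
qed

section \<open>The balanced digit sum is the length\<close>

text \<open>
  The sum of the absolute values of the digits of \<open>n\<close> in balanced base \<open>2 * m + 1\<close>. The guard
  \<open>m < 1\<close> is there for termination: for \<open>m = 0\<close>, say, the base is 1 and the quotient is \<open>n\<close> itself.
\<close>

function digit_sum :: "int \<Rightarrow> int \<Rightarrow> nat" where
  "digit_sum m n =
     (if m < 1 \<or> n = 0 then 0
      else nat \<bar>(n + m) mod (2 * m + 1) - m\<bar> + digit_sum m ((n + m) div (2 * m + 1)))"
  by auto

text \<open>
  Shifting by \<open>m\<close> moves the balanced residues \<open>- m..m\<close> to the standard residues \<open>0..2 * m\<close>.
  The bound on the quotient makes recursion over the digits terminate.
\<close>

lemma balanced_decomposition:
  fixes m n :: int
  assumes "m \<ge> 1"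
  obtains x s where "n = (2 * m + 1) * x + s" "\<bar>s\<bar> \<le> m" "n \<noteq> 0 \<Longrightarrow> \<bar>x\<bar> < \<bar>n\<bar>"
    "(n + m) div (2 * m + 1) = x"
proof -
  define x where "x = (n + m) div (2 * m + 1)"
  define s where "s = (n + m) mod (2 * m + 1) - m"
  have n: "n = (2 * m + 1) * x + s"
    unfolding x_def s_def using mult_div_mod_eq[of "2 * m + 1" "n + m"] by linarith
  have s: "\<bar>s\<bar> \<le> m"
    unfolding s_def using assms pos_mod_bound[of "2 * m + 1" "n + m"]
      pos_mod_sign[of "2 * m + 1" "n + m"] by linarith
  have "\<bar>x\<bar> < \<bar>n\<bar>" if "n \<noteq> 0"
  proof (cases "x = 0")
    case False
    have "2 * m * 1 \<le> 2 * m * \<bar>x\<bar>" by (rule mult_left_mono) (use False assms in auto)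
    moreover have "(2 * m + 1) * \<bar>x\<bar> = 2 * m * \<bar>x\<bar> + \<bar>x\<bar>" by (simp add: distrib_right)
    moreover have "(2 * m + 1) * \<bar>x\<bar> \<le> \<bar>n\<bar> + \<bar>s\<bar>"
      using n assms abs_triangle_ineq[of n "-s"] by (simp add: abs_mult)
    ultimately show ?thesis using s assms by linarith
  qed (use that in auto)
  then show thesis using that[OF n s _ x_def[symmetric]] by blast
qed

termination digit_sum
proof (relation "Wellfounded.measure (\<lambda>(m, n). nat \<bar>n\<bar>)", simp, goal_cases)
  case (1 m n)
  then have m: "m \<ge> 1" and n: "n \<noteq> 0" by auto
  obtain x where "\<bar>x\<bar> < \<bar>n\<bar>" "(n + m) div (2 * m + 1) = x"
    using balanced_decomposition[OF m, of n] n by metis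
  then show ?case by simp
qed

declare digit_sum.simps [simp del]

lemma digit_sum_zero [simp]: "digit_sum m 0 = 0"
  by (simp add: digit_sum.simps)

text \<open>
  By uniqueness of the balanced residue, \<open>s\<close> is the last digit and \<open>x\<close> encodes the others. All
  later facts about the digit sum use this equation instead of its definition.
\<close>

lemma digit_sum_append:
  assumes "m \<ge> 1" and "\<bar>s\<bar> \<le> m"
  shows "digit_sum m ((2 * m + 1) * x + s) = nat \<bar>s\<bar> + digit_sum m x"
proof -
  let ?g = "2 * m + 1"
  have dm: "(?g * x + s + m) div ?g = x" "(?g * x + s + m) mod ?g = s + m"
    using int_div_pos_eq[of "?g * x + s + m" ?g x "s + m"]
      int_mod_pos_eq[of "?g * x + s + m" ?g x "s + m"] assms by auto
  show ?thesis
  proof (cases "?g * x + s = 0")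
    case True
    then have "x = 0" using dm(1) assms by simp
    then show ?thesis using True by simp
  next
    case False
    then show ?thesis using assms(1) dm by (subst digit_sum.simps) simp
  qed
qed

lemma digit_sum_small:
  assumes "m \<ge> 1" and "\<bar>s\<bar> \<le> m"
  shows "digit_sum m s = nat \<bar>s\<bar>"
  using digit_sum_append[OF assms, of 0] by simp

lemma balanced_induct [consumes 1, case_names zero append]:
  assumes m: "m \<ge> (1::int)"
    and "P 0"
    and append: "\<And>x s. \<bar>s\<bar> \<le> m \<Longrightarrow> (2 * m + 1) * x + s \<noteq> 0 \<Longrightarrow> P x \<Longrightarrow> P ((2 * m + 1) * x + s)"
  shows "P n"
proof (induction "nat \<bar>n\<bar>" arbitrary: n rule: less_induct)
  case less
  show ?case
  proof (cases "n = 0")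
    case False
    obtain x s where "n = (2 * m + 1) * x + s" "\<bar>s\<bar> \<le> m" "\<bar>x\<bar> < \<bar>n\<bar>"
      using balanced_decomposition[OF m, of n] False by metis
    then show ?thesis using append[of s x] less[of x] False by auto
  qed (use assms in simp)
qed

lemma digit_sum_uminus:
  assumes "m \<ge> 1"
  shows "digit_sum m (- n) = digit_sum m n"
  using assms
proof (induction n rule: balanced_induct)
  case (append x s)
  then show ?case
    using digit_sum_append[OF assms, of s x] digit_sum_append[OF assms, of "- s" "- x"] by simp
qed simp

text \<open>
  When the last digit is \<open>m\<close>, the carry turns it into \<open>- m\<close> at no cost, so only the induction
  hypothesis for the quotient contributes. This is where oddness of the base matters: its balanced
  digits are symmetric about 0.
\<close>

lemma digit_sum_add_one:
  assumes "m \<ge> 1"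
  shows "digit_sum m (n + 1) \<le> digit_sum m n + 1"
  using assms
proof (induction n rule: balanced_induct)
  case zero
  then show ?case using digit_sum_small[OF assms, of 1] assms by simp
next
  case (append x s)
  show ?case
  proof (cases "s = m")
    case True
    have "(2 * m + 1) * x + s + 1 = (2 * m + 1) * (x + 1) + (- m)"
      using True by (simp add: algebra_simps)
    then have "digit_sum m ((2 * m + 1) * x + s + 1) = nat m + digit_sum m (x + 1)"
      using digit_sum_append[OF assms, of "- m" "x + 1"] assms by (simp only: abs_minus_cancel abs_of_nonneg)
    then show ?thesis
      using digit_sum_append[OF assms, of m x] append(3) True assms by (simp only: abs_of_nonneg)
  next
    case False
    then have "\<bar>s + 1\<bar> \<le> m" using append by linarith
    from digit_sum_append[OF assms this, of x] digit_sum_append[OF assms, of s x] append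
    show ?thesis by (simp add: add.assoc)
  qed
qed

lemma digit_sum_add_power:
  assumes "m \<ge> 1"
  shows "digit_sum m (n + (2 * m + 1) ^ i) \<le> digit_sum m n + 1"
proof (induction i arbitrary: n)
  case 0
  then show ?case using digit_sum_add_one[OF assms] by simp
next
  case (Suc i)
  obtain x s where n: "n = (2 * m + 1) * x + s" "\<bar>s\<bar> \<le> m"
    using balanced_decomposition[OF assms, of n] by metis
  have "n + (2 * m + 1) ^ Suc i = (2 * m + 1) * (x + (2 * m + 1) ^ i) + s"
    using n by (simp add: distrib_left)
  then have "digit_sum m (n + (2 * m + 1) ^ Suc i)
      = nat \<bar>s\<bar> + digit_sum m (x + (2 * m + 1) ^ i)"
    using digit_sum_append[OF assms n(2)] by (simp only:)
  then show ?case
    using digit_sum_append[OF assms n(2), of x] Suc[of x] by (simp only: n(1))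
qed

lemma digit_sum_diff_power:
  assumes "m \<ge> 1"
  shows "digit_sum m (n - (2 * m + 1) ^ i) \<le> digit_sum m n + 1"
  using digit_sum_add_power[OF assms, of "- n" i]
    digit_sum_uminus[OF assms, of "n - (2 * m + 1) ^ i"] digit_sum_uminus[OF assms, of n]
  by simp

text \<open>
  The step moves the lowest nonzero digit one unit towards 0.
\<close>

lemma digit_sum_descent:
  assumes "m \<ge> 1" and "n \<noteq> 0"
  shows "\<exists>s\<in>gen_powers (2 * m + 1). digit_sum m n = digit_sum m (n - s) + 1"
  using assms
proof (induction n rule: balanced_induct)
  case zero
  then show ?case by simp
next
  case (append x s)
  let ?g = "2 * m + 1"
  note m = \<open>m \<ge> 1\<close>
  show ?case
  proof (cases "s = 0")
    case True
    then have "x \<noteq> 0" using append by auto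
    then obtain t where t: "t \<in> gen_powers ?g" "digit_sum m x = digit_sum m (x - t) + 1"
      using append by auto
    from t(1) obtain i where "t = ?g ^ i \<or> t = - (?g ^ i)" by (auto simp: gen_powers_def)
    then have "?g * t = ?g ^ Suc i \<or> ?g * t = - (?g ^ Suc i)" by auto
    then have "?g * t \<in> gen_powers ?g" unfolding gen_powers_def by blast
    moreover have "digit_sum m (?g * x) = digit_sum m (?g * x - ?g * t) + 1"
      using digit_sum_append[OF m, of 0 x] digit_sum_append[OF m, of 0 "x - t"] t(2) m
      by (simp add: right_diff_distrib)
    ultimately show ?thesis using True by auto
  next
    case False
    have "\<bar>s - sgn s\<bar> = \<bar>s\<bar> - 1" using False by (auto simp: sgn_if abs_if)
    then have "digit_sum m (?g * x + s) = digit_sum m (?g * x + s - sgn s) + 1"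
      using digit_sum_append[OF m, of s x] digit_sum_append[OF m, of "s - sgn s" x] append False
      by (simp add: add_diff_eq nat_diff_distrib)
    moreover have "sgn s = ?g ^ 0 \<or> sgn s = - (?g ^ 0)" using False by (auto simp: sgn_if)
    then have "sgn s \<in> gen_powers ?g" unfolding gen_powers_def by blast
    ultimately show ?thesis by blast
  qed
qed

theorem g_length_eq_digit_sum:
  assumes m: "m \<ge> 1"
  shows "g_length (2 * m + 1) n = ereal (real (digit_sum m n))"
  unfolding g_length_def
proof (rule cayley_dist_eqI)
  fix x s :: int
  assume "s \<in> gen_powers (2 * m + 1)"
  then obtain i where "s = (2 * m + 1) ^ i \<or> s = - ((2 * m + 1) ^ i)"
    by (auto simp: gen_powers_def)
  then show "digit_sum m (x + s) \<le> digit_sum m x + 1 \<and> digit_sum m x \<le> digit_sum m (x + s) + 1"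
    using digit_sum_add_power[OF m, of x i] digit_sum_diff_power[OF m, of x i]
      digit_sum_add_power[OF m, of "x + s" i] digit_sum_diff_power[OF m, of "x + s" i]
    by auto
next
  fix x :: int
  assume "x \<noteq> 0"
  then obtain s where "s \<in> gen_powers (2 * m + 1)" "digit_sum m x = digit_sum m (x - s) + 1"
    using digit_sum_descent[OF m] by blast
  then show "\<exists>y. (y, x) \<in> parcs (cayley_graph (gen_powers (2 * m + 1))) \<and>
               digit_sum m x = digit_sum m y + 1"
    by (intro exI[of _ "x - s"]) (auto simp: cayley_graph_def)
qed simp

section \<open>The least positive integer of given length\<close>

text \<open>
  The integer with top digit \<open>a\<close> in position \<open>d\<close> and all \<open>d\<close> lower digits equal to \<open>- m\<close>.
\<close>

fun least_with_top :: "int \<Rightarrow> int \<Rightarrow> nat \<Rightarrow> int" where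
  "least_with_top m a 0 = a"
| "least_with_top m a (Suc d) = (2 * m + 1) * least_with_top m a d - m"

lemma least_with_top_closed: "2 * least_with_top m a d = (2 * a - 1) * (2 * m + 1) ^ d + 1"
proof (induction d)
  case (Suc d)
  have "2 * least_with_top m a (Suc d) = (2 * m + 1) * (2 * least_with_top m a d) - 2 * m"
    by (simp add: algebra_simps)
  also have "\<dots> = (2 * a - 1) * (2 * m + 1) ^ Suc d + 1"
    unfolding Suc.IH by (simp add: algebra_simps)
  finally show ?case .
qed simp

lemma digit_sum_least_with_top:
  assumes "m \<ge> 1" "1 \<le> a" "a \<le> m"
  shows "int (digit_sum m (least_with_top m a d)) = m * int d + a"
proof (induction d)
  case 0
  then show ?case using digit_sum_small[of m a] assms by simp
next
  case (Suc d)
  then show ?case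
    using digit_sum_append[of m "- m" "least_with_top m a d"] assms by (simp add: algebra_simps)
qed

text \<open>
  If \<open>\<bar>n\<bar> < g * y - m\<close>, the balanced quotient \<open>x\<close> of \<open>n\<close> satisfies
  \<open>g * \<bar>x\<bar> \<le> \<bar>n\<bar> + m < g * y\<close>. So the bound on \<open>n\<close> passes to the quotient in the recursion for
  \<open>least_with_top\<close>, while the last digit adds at most \<open>m\<close>.
\<close>

lemma digit_sum_below_least_with_top:
  assumes "m \<ge> 1" "1 \<le> a" "a \<le> m" "\<bar>n\<bar> < least_with_top m a d"
  shows "int (digit_sum m n) < m * int d + a"
  using assms(4)
proof (induction d arbitrary: n)
  case 0
  then show ?case using digit_sum_small[of m n] assms by simp
next
  case (Suc d)
  let ?g = "2 * m + 1"
  obtain x s where n: "n = ?g * x + s" "\<bar>s\<bar> \<le> m"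
    using balanced_decomposition[OF assms(1), of n] by metis
  have "?g * \<bar>x\<bar> = \<bar>?g * x\<bar>" using assms(1) by (simp add: abs_mult)
  also have "\<dots> < ?g * least_with_top m a d" using Suc.prems n by simp
  finally have "\<bar>x\<bar> < least_with_top m a d" using assms(1) by simp
  from Suc.IH[OF this] show ?case
    using digit_sum_append[OF assms(1) n(2), of x] n by (simp add: algebra_simps)
qed

theorem lambda_g_eq_least_with_top:
  assumes "m \<ge> 1" "1 \<le> a" "a \<le> m"
  shows "lambda_g (2 * m + 1) (m * int d + a) = least_with_top m a d"
  unfolding lambda_g_def
proof (rule Least_equality)
  have "(2 * a - 1) * (2 * m + 1) ^ d > 0" using assms by simp
  then have "least_with_top m a d > 0" using least_with_top_closed[of m a d] by linarith
  moreover have "g_length (2 * m + 1) (least_with_top m a d) = ereal (of_int (m * int d + a))"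
    using g_length_eq_digit_sum[OF assms(1)] digit_sum_least_with_top[OF assms, of d]
    by (metis of_int_of_nat_eq)
  ultimately show "0 < least_with_top m a d \<and>
      g_length (2 * m + 1) (least_with_top m a d) = ereal (of_int (m * int d + a))" by blast
next
  fix n :: int
  assume n: "0 < n \<and> g_length (2 * m + 1) n = ereal (of_int (m * int d + a))"
  then have "real_of_int (int (digit_sum m n)) = of_int (m * int d + a)"
    using g_length_eq_digit_sum[OF assms(1), of n] by simp
  then have "int (digit_sum m n) = m * int d + a" by linarith
  then show "least_with_top m a d \<le> n"
    using digit_sum_below_least_with_top[OF assms, of n d] n by linarith
qed

theorem theorem3p6:
  fixes g k q r :: int and A B :: rat
  assumes "g > 1" and "odd g" and "k > 0"
    and q: "q = \<lfloor>2 * rat_of_int k / (rat_of_int g - 1)\<rfloor>"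
    and r: "r = k mod ((g - 1) div 2)"
    and A: "A = (if r = 0 then (rat_of_int g - 1) / 2 else - ((rat_of_int g - 1) / 2))"
    and B: "B = (if r = 0 then 0 else rat_of_int r)"
  shows "rat_of_int (lambda_g g k) =
           (1 - rat_of_int g powi (q - 1)) / 2
             + A * rat_of_int g powi (q - 1) + B * rat_of_int g powi q"
proof -
  define m where "m = (g - 1) div 2"
  have g: "g = 2 * m + 1" and m: "m \<ge> 1"
    using assms(1,2) unfolding m_def by (auto elim!: oddE)
  have "2 * rat_of_int k / (rat_of_int g - 1) = rat_of_int k / rat_of_int m"
    using g m by simp
  then have q': "q = k div m" using q by (simp add: floor_divide_of_int_eq)
  have r': "r = k mod m" using r m_def by simp
  have k: "k = m * q + r" unfolding q' r' by simp
  have r_bounds: "0 \<le> r" "r < m" using m r' by auto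
  have q0: "q \<ge> 0" using q' m assms(3) by (simp add: pos_imp_zdiv_nonneg_iff)
  have closed: "rat_of_int (least_with_top m a d)
      = ((2 * rat_of_int a - 1) * rat_of_int g ^ d + 1) / 2" for a d
  proof -
    have "2 * rat_of_int (least_with_top m a d) = rat_of_int (2 * least_with_top m a d)" by simp
    also have "\<dots> = (2 * rat_of_int a - 1) * rat_of_int g ^ d + 1"
      unfolding least_with_top_closed g by simp
    finally show ?thesis by simp
  qed
  show ?thesis
  proof (cases "r = 0")
    case True
    have "q \<noteq> 0" using True k assms(3) by auto
    then have d: "int (nat (q - 1)) = q - 1" using q0 by simp
    have "k = m * int (nat (q - 1)) + m" unfolding d using k True by (simp add: algebra_simps)
    then have "lambda_g g k = least_with_top m m (nat (q - 1))"
      using lambda_g_eq_least_with_top[of m m "nat (q - 1)"] m g by simp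
    moreover have "rat_of_int g powi (q - 1) = rat_of_int g ^ nat (q - 1)"
      by (metis d power_int_of_nat)
    ultimately show ?thesis
      using closed[of m "nat (q - 1)"] True A B g by (simp add: field_simps)
  next
    case False
    have "k = m * int (nat q) + r" using k q0 by simp
    then have "lambda_g g k = least_with_top m r (nat q)"
      using lambda_g_eq_least_with_top[of m r "nat q"] m g r_bounds False by simp
    moreover have pq: "rat_of_int g powi q = rat_of_int g ^ nat q"
      using q0 by (metis int_nat_eq power_int_of_nat)
    moreover have "rat_of_int g * rat_of_int g powi (q - 1) = rat_of_int g powi q"
      using assms(1) by (simp add: power_int_diff)
    moreover have "(1 - u) / 2 + A * u + B * (rat_of_int g * u)
        = ((2 * rat_of_int r - 1) * (rat_of_int g * u) + 1) / 2" for u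
    proof -
      have "A = - ((rat_of_int g - 1) / 2)" "B = rat_of_int r" using A B False by auto
      then show ?thesis by (simp only:) (simp add: field_simps)
    qed
    ultimately show ?thesis
      using closed[of r "nat q"] by metis
  qed
qed

end
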